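(* Let $n\ge 3$ and, for $0<\alpha<1$, let $c_\alpha=-2\log\alpha$ be the upper $\alpha$ point of the $\chi^2_2$ distribution. Under independent normal sampling, the test rejecting when $\mathrm{JB}_n>c_\alpha$ has exact size zero (that is, $P(\mathrm{JB}_n>c_\alpha)=0$) if and only if $J_n^+\le c_\alpha$, where $$J_n^+=\frac{n\{(n-2)^4+4(n-1)^2\}}{24(n-1)^2}.$$ Hence the asymptotic $10\%$ test ($\alpha=0.10$) and the asymptotic $5\%$ test ($\alpha=0.05$) have exact size zero if and only if $n\le 6$, and the asymptotic $1\%$ test ($\alpha=0.01$) has exact size zero if and only if $n\le 7$.
   Context: Let $X_1,\dots,X_n$ be independent $N(\mu,\sigma^2)$ with $\sigma>0$, $\bar X=n^{-1}\sum_i X_i$, $m_r=n^{-1}\sum_{i=1}^n(X_i-\bar X)^r$, $S_n=m_3/m_2^{3/2}$, $K_n=m_4/m_2^2$ (defined almost surely). The Jarque--Bera statistic is $\mathrm{JB}_n=\frac n6\{S_n^2+\frac14(K_n-3)^2\}$. The number $J_n^+$ is the largest value that $\mathrm{JB}_n$ can attain. *)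

theory Defs
  imports "HOL-Probability.Probability"
begin

definition sample_mean :: "nat \<Rightarrow> (nat \<Rightarrow> real) \<Rightarrow> real" where
  "sample_mean n x = (\<Sum>i=1..n. x i) / real n"

definition central_moment :: "nat \<Rightarrow> nat \<Rightarrow> (nat \<Rightarrow> real) \<Rightarrow> real" where
  "central_moment r n x = (\<Sum>i=1..n. (x i - sample_mean n x) ^ r) / real n"

definition skewness :: "nat \<Rightarrow> (nat \<Rightarrow> real) \<Rightarrow> real" where
  "skewness n x = central_moment 3 n x / central_moment 2 n x powr (3 / 2)"

definition kurtosis :: "nat \<Rightarrow> (nat \<Rightarrow> real) \<Rightarrow> real" where
  "kurtosis n x = central_moment 4 n x / (central_moment 2 n x)\<^sup>2"

(* On constant samples (second central moment 0) the statistic is mathematically undefined;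
   here it takes a junk value from division by 0.  Under normal sampling with n >= 2 this
   happens on a null event, and such samples are excluded from JB_values. *)
definition JB :: "nat \<Rightarrow> (nat \<Rightarrow> real) \<Rightarrow> real" where
  "JB n x = real n / 6 * ((skewness n x)\<^sup>2 + 1 / 4 * (kurtosis n x - 3)\<^sup>2)"

definition JB_values :: "nat \<Rightarrow> real set" where
  "JB_values n = {JB n x | x. central_moment 2 n x \<noteq> 0}"

definition J_plus :: "nat \<Rightarrow> real" where
  "J_plus n = (GREATEST v. v \<in> JB_values n)"

definition chi_square_density :: "nat \<Rightarrow> real \<Rightarrow> real" where
  "chi_square_density k x =
     (if x > 0
      then x powr (real k / 2 - 1) * exp (- x / 2) / (2 powr (real k / 2) * Gamma (real k / 2))
      else 0)"

definition chi_square :: "nat \<Rightarrow> real measure" where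
  "chi_square k = density lborel (\<lambda>x. ennreal (chi_square_density k x))"

definition is_upper_point :: "real measure \<Rightarrow> real \<Rightarrow> real \<Rightarrow> bool" where
  "is_upper_point D \<alpha> c \<longleftrightarrow> measure D {c<..} = \<alpha>"

definition crit :: "real \<Rightarrow> real" where
  "crit \<alpha> = - 2 * ln \<alpha>"

definition normal_sample ::
  "'a measure \<Rightarrow> nat \<Rightarrow> real \<Rightarrow> real \<Rightarrow> (nat \<Rightarrow> 'a \<Rightarrow> real) \<Rightarrow> bool" where
  "normal_sample M n \<mu> \<sigma> X \<longleftrightarrow>
     prob_space.indep_vars M (\<lambda>_. borel) X {1..n} \<and>
     (\<forall>i\<in>{1..n}. distributed M lborel (X i) (normal_density \<mu> \<sigma>))"

definition rejection_prob :: "'a measure \<Rightarrow> nat \<Rightarrow> (nat \<Rightarrow> 'a \<Rightarrow> real) \<Rightarrow> real \<Rightarrow> real" where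
  "rejection_prob M n X \<alpha> = \<P>(\<omega> in M. JB n (\<lambda>i. X i \<omega>) > crit \<alpha>)"

end

theory Submission
  imports Defs
begin

text \<open>
  Write \<open>S\<close> and \<open>K\<close> for skewness and kurtosis. Two moment inequalities hold for every nonconstant
  sample of size \<open>n \<ge> 3\<close>: Pearson's \<open>S\<^sup>2 \<le> K - 1\<close> (\<open>skewness_square_le_kurtosis\<close>) and
  \<open>K - 1 \<le> (n - 2)\<^sup>2 / (n - 1)\<close> (\<open>kurtosis_le\<close>). By the first,
  \<open>S\<^sup>2 + (K - 3)\<^sup>2 / 4 \<le> ((K - 1)\<^sup>2 + 4) / 4\<close>, and the right-hand side increases with \<open>K\<close>, so the second
  bounds the statistic by the claimed maximum. Both inequalities are equalities for the sample in
  which one observation differs from all others, which agree (\<open>one_outlier\<close>); hence the maximum is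
  attained there.

  The bound on \<open>K\<close> is the hard part. It concerns \<open>n\<close> numbers with sum zero and given sum of squares,
  and asks for the largest sum of fourth powers. The proof isolates the entry of largest absolute
  value: either its square is too small for the sum of fourth powers to be large, or the other
  entries are nearly equal and their contribution can be expanded around the extremal
  configuration (\<open>zero_sum_fourth_power_le\<close>).

  For the probabilistic part, a critical value that is at least the maximum can only be exceeded at
  constant samples, which form a null event; a critical value below the maximum is exceeded on a
  neighbourhood of the extremal sample, which has positive probability because the normal
  density is positive everywhere (\<open>rejection_prob_eq_0_iff\<close>). The statements about the three levels
  follow since the maximum increases with \<open>n\<close> and takes at 6, 7 and 8 approximately the values
  3.56, 6.23 and 10.15, while the critical values are approximately 4.61, 5.99 and 9.21.
\<close>


section \<open>Fourth powers of numbers with sum zero\<close>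

text \<open>Since \<open>f i\<close> is minus the sum of the other entries, Cauchy-Schwarz on those entries bounds it.\<close>

lemma zero_sum_square_le:
  fixes f :: "'a \<Rightarrow> real"
  assumes "finite A" "i \<in> A" "sum f A = 0"
  shows "real (card A) * (f i)\<^sup>2 \<le> (real (card A) - 1) * (\<Sum>j\<in>A. (f j)\<^sup>2)"
proof -
  let ?B = "A - {i}"
  have card: "real (card ?B) = real (card A) - 1"
    using card.remove[OF assms(1,2)] by simp
  have "sum f A = f i + sum f ?B" "(\<Sum>j\<in>A. (f j)\<^sup>2) = (f i)\<^sup>2 + (\<Sum>j\<in>?B. (f j)\<^sup>2)"
    by (rule sum.remove[OF assms(1,2)])+
  moreover from this have "f i = - sum f ?B" using assms(3) by simp
  moreover have "(sum f ?B)\<^sup>2 \<le> real (card ?B) * (\<Sum>j\<in>?B. (f j)\<^sup>2)"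
    using assms sum_squared_le_sum_of_squares[of f ?B] by (simp add: mult.commute)
  ultimately show ?thesis unfolding card by (simp add: algebra_simps)
qed

text \<open>The cubic term of the expansion is absorbed by \<open>-4dw\<^sup>3 \<le> 2d\<^sup>2w\<^sup>2 + 2w\<^sup>4\<close>. The linear term
  stays exact because it vanishes after summation over a family \<open>w\<close> with sum zero.\<close>

lemma shifted_fourth_power_le:
  fixes w d :: real
  shows "(w - d) ^ 4 \<le> 3 * w ^ 4 + 8 * d\<^sup>2 * w\<^sup>2 - 4 * d ^ 3 * w + d ^ 4"
proof -
  have "3 * w ^ 4 + 8 * d\<^sup>2 * w\<^sup>2 - 4 * d ^ 3 * w + d ^ 4 - (w - d) ^ 4 = 2 * (w * (w + d))\<^sup>2"
    by (simp add: power4_eq_xxxx power2_eq_square power3_eq_cube algebra_simps)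
  moreover have "0 \<le> 2 * (w * (w + d))\<^sup>2" by simp
  ultimately show ?thesis by linarith
qed

text \<open>The numerical inequality to which the fourth-power bound reduces when the largest square is
  \<open>Nq - \<delta>\<close> with small \<open>\<delta>\<close>. The difference of the two sides, multiplied by \<open>N\<^sup>3\<close>, is \<open>\<delta>\<close> times a
  decreasing linear function of \<open>\<delta>\<close>, so only the right end of the range of \<open>\<delta>\<close> has to be checked. There
  the inequality is polynomial in \<open>N\<close>, and all its coefficients are nonnegative after the
  substitution \<open>N = 3 + s\<close>.\<close>

lemma remainder_bound:
  fixes N q \<delta> :: real
  assumes N: "N \<ge> 3" and "0 \<le> \<delta>" "\<delta> \<le> q * (N - 1) / N"
  shows "(N*q - \<delta>)\<^sup>2 + 3 * (N - 1) / N * ((N + 1) / N * \<delta>)\<^sup>2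
      + 8 * ((N*q - \<delta>) / N\<^sup>2) * ((N + 1) / N * \<delta>) + (N*q - \<delta>)\<^sup>2 / N ^ 3
     \<le> (N + 1) * q\<^sup>2 * (N\<^sup>2 - N + 1) / N" (is "?L \<le> ?R")
proof -
  have "N ^ 3 * (?R - ?L) = \<delta> * ((2 * N ^ 4 - 8 * N\<^sup>2 - 6 * N) * q - (4 * N ^ 3 + 3 * N\<^sup>2 - 11 * N - 10) * \<delta>)"
  proof -
    have "N ^ 3 * (3 * (N - 1) / N * ((N + 1) / N * \<delta>)\<^sup>2) = 3 * (N - 1) * ((N + 1) * \<delta>)\<^sup>2"
      "N ^ 3 * (8 * ((N*q - \<delta>) / N\<^sup>2) * ((N + 1) / N * \<delta>)) = 8 * (N*q - \<delta>) * ((N + 1) * \<delta>)"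
      "N ^ 3 * ((N*q - \<delta>)\<^sup>2 / N ^ 3) = (N*q - \<delta>)\<^sup>2"
      "N ^ 3 * ((N + 1) * q\<^sup>2 * (N\<^sup>2 - N + 1) / N) = N\<^sup>2 * ((N + 1) * q\<^sup>2 * (N\<^sup>2 - N + 1))"
      using N by (simp_all add: power2_eq_square power3_eq_cube)
    then have "N ^ 3 * (?R - ?L) = N\<^sup>2 * ((N + 1) * q\<^sup>2 * (N\<^sup>2 - N + 1)) - (N ^ 3 * (N*q - \<delta>)\<^sup>2
        + 3 * (N - 1) * ((N + 1) * \<delta>)\<^sup>2 + 8 * (N*q - \<delta>) * ((N + 1) * \<delta>) + (N*q - \<delta>)\<^sup>2)"
      by (simp only: right_diff_distrib distrib_left)
    also have "\<dots> = \<delta> * ((2 * N ^ 4 - 8 * N\<^sup>2 - 6 * N) * q - (4 * N ^ 3 + 3 * N\<^sup>2 - 11 * N - 10) * \<delta>)"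
      by algebra
    finally show ?thesis .
  qed
  moreover have "(4 * N ^ 3 + 3 * N\<^sup>2 - 11 * N - 10) * \<delta> \<le> (2 * N ^ 4 - 8 * N\<^sup>2 - 6 * N) * q"
  proof -
    define s where "s = N - 3"
    have s: "N = 3 + s" "s \<ge> 0" using N by (auto simp: s_def)
    have q: "q \<ge> 0"
    proof (rule ccontr)
      assume "\<not> q \<ge> 0"
      then have "q * (N - 1) / N < 0" using N by (intro divide_neg_pos mult_neg_pos) auto
      then show False using assms by linarith
    qed
    have c: "4 * N ^ 3 + 3 * N\<^sup>2 - 11 * N - 10 \<ge> 0" unfolding s(1) using s(2)
      by (simp add: power2_eq_square power3_eq_cube algebra_simps)
    have p: "(4 * N ^ 3 + 3 * N\<^sup>2 - 11 * N - 10) * (N - 1) \<le> (2 * N ^ 4 - 8 * N\<^sup>2 - 6 * N) * N"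
      unfolding s(1) using s(2)
      by (simp add: power2_eq_square power3_eq_cube power4_eq_xxxx algebra_simps)
    have "(4 * N ^ 3 + 3 * N\<^sup>2 - 11 * N - 10) * \<delta> \<le> (4 * N ^ 3 + 3 * N\<^sup>2 - 11 * N - 10) * (q * (N - 1) / N)"
      using c assms by (intro mult_left_mono) auto
    also have "\<dots> = q / N * ((4 * N ^ 3 + 3 * N\<^sup>2 - 11 * N - 10) * (N - 1))" by simp
    also have "\<dots> \<le> q / N * ((2 * N ^ 4 - 8 * N\<^sup>2 - 6 * N) * N)"
      using p q N by (intro mult_left_mono) auto
    also have "\<dots> = (2 * N ^ 4 - 8 * N\<^sup>2 - 6 * N) * q" using N by simp
    finally show ?thesis .
  qed
  ultimately have "0 \<le> N ^ 3 * (?R - ?L)" using assms by simp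
  moreover have "N ^ 3 > 0" using N by simp
  ultimately have "0 \<le> ?R - ?L" using zero_le_mult_iff[of "N ^ 3" "?R - ?L"] by linarith
  then show ?thesis by linarith
qed

text \<open>Under both constraints the sum of fourth powers is largest when one entry is isolated and all
  others coincide; the right-hand side is its value there. Let \<open>T\<close> be the largest square, so that
  \<open>T \<le> Nq\<close>. If \<open>T\<close> is far from \<open>Nq\<close>, the crude estimate \<open>\<Sum>f\<^sup>4 \<le> T \<Sum>f\<^sup>2\<close> is enough. If \<open>T\<close> is
  close to \<open>Nq\<close>, the remaining entries are nearly constant: their deviations \<open>w\<close> from their own
  mean \<open>-d\<close> have sum of squares proportional to \<open>\<delta> = Nq - T\<close>, and so what they add to the
  fourth powers is outweighed by the loss in \<open>T\<^sup>2\<close>. The estimate of this second case is too coarse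
  for \<open>N = 2\<close>, where the sum of fourth powers is determined by the sum of squares.\<close>

lemma zero_sum_fourth_power_le:
  fixes f :: "'a \<Rightarrow> real" and N q :: real
  assumes fin: "finite A" and card: "real (card A) = N + 1" and N: "N \<ge> 3"
    and sum0: "sum f A = 0" and sq: "(\<Sum>j\<in>A. (f j)\<^sup>2) = (N + 1) * q"
  shows "(\<Sum>j\<in>A. f j ^ 4) \<le> (N + 1) * q\<^sup>2 * (N\<^sup>2 - N + 1) / N"
proof -
  have "A \<noteq> {}" using card N by auto
  then have "Max ((\<lambda>j. (f j)\<^sup>2) ` A) \<in> (\<lambda>j. (f j)\<^sup>2) ` A"
    using fin by (intro Max_in) auto
  then obtain i where i: "i \<in> A" and i_max: "Max ((\<lambda>j. (f j)\<^sup>2) ` A) = (f i)\<^sup>2"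
    by auto
  have max: "(f j)\<^sup>2 \<le> (f i)\<^sup>2" if "j \<in> A" for j
    using that fin unfolding i_max[symmetric] by simp
  have q: "q \<ge> 0"
    using sum_nonneg[of A "\<lambda>j. (f j)\<^sup>2"] N by (simp add: sq zero_le_mult_iff)
  define T where "T = (f i)\<^sup>2"
  define \<delta> where "\<delta> = N * q - T"
  have \<delta>: "\<delta> \<ge> 0"
    using zero_sum_square_le[OF fin i sum0] N unfolding sq card \<delta>_def T_def by (simp add: mult.left_commute)
  \<comment> \<open>At the threshold \<open>q(N - 1)/N\<close> the crude estimate by \<open>T\<close> gives exactly the claimed bound.\<close>
  show ?thesis
  proof (cases "\<delta> \<le> q * (N - 1) / N")
    case False
    have T: "T \<le> q * (N\<^sup>2 - N + 1) / N"
    proof -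
      have "q * (N\<^sup>2 - N + 1) / N = N * q - q * (N - 1) / N" using N by (simp add: field_simps power2_eq_square)
      then show ?thesis using False \<delta>_def by simp
    qed
    have "(\<Sum>j\<in>A. f j ^ 4) = (\<Sum>j\<in>A. (f j)\<^sup>2 * (f j)\<^sup>2)" by (simp flip: power_add)
    also have "\<dots> \<le> (\<Sum>j\<in>A. T * (f j)\<^sup>2)"
      using max by (intro sum_mono mult_right_mono) (auto simp: T_def)
    also have "\<dots> = T * ((N + 1) * q)" by (simp add: sq flip: sum_distrib_left)
    also have "\<dots> \<le> q * (N\<^sup>2 - N + 1) / N * ((N + 1) * q)" using T q N by (intro mult_right_mono) auto
    finally show ?thesis by (simp add: power2_eq_square mult_ac)
  next
    case True
    define B where "B = A - {i}"
    define d where "d = f i / N"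
    define w where "w j = f j + d" for j
    define W where "W = (\<Sum>j\<in>B. (w j)\<^sup>2)"
    have B: "finite B" "real (card B) = N"
      using fin card card.remove[OF fin i] by (auto simp: B_def)
    have fB: "sum f B = - f i" "(\<Sum>j\<in>B. (f j)\<^sup>2) = (N + 1) * q - T"
      using sum.remove[OF fin i, of f] sum.remove[OF fin i, of "\<lambda>j. (f j)\<^sup>2"] sum0 sq
      by (auto simp: B_def T_def)
    have w0: "sum w B = 0"
      using N by (simp add: w_def sum.distrib fB B d_def)
    have d2: "d\<^sup>2 = T / N\<^sup>2" by (simp add: d_def T_def power_divide)
    have "W = (\<Sum>j\<in>B. (f j)\<^sup>2 + 2 * d * f j + d\<^sup>2)"
      by (simp add: W_def w_def power2_sum mult_ac add_ac)
    also have "\<dots> = (\<Sum>j\<in>B. (f j)\<^sup>2) + 2 * d * sum f B + N * d\<^sup>2"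
      by (simp add: sum.distrib B flip: sum_distrib_left)
    also have "\<dots> = (N + 1) / N * \<delta>"
      unfolding fB d2 using N by (simp add: d_def T_def \<delta>_def field_simps power2_eq_square)
    finally have W: "W = (N + 1) / N * \<delta>" .
    have w_sq: "(w j)\<^sup>2 \<le> (N - 1) / N * W" if "j \<in> B" for j
      using zero_sum_square_le[OF B(1) that w0] N unfolding B(2) W_def by (simp add: pos_le_divide_eq mult.commute)
    have w4: "(\<Sum>j\<in>B. w j ^ 4) \<le> (N - 1) / N * W\<^sup>2"
    proof -
      have "(\<Sum>j\<in>B. w j ^ 4) = (\<Sum>j\<in>B. (w j)\<^sup>2 * (w j)\<^sup>2)" by (simp flip: power_add)
      also have "\<dots> \<le> (\<Sum>j\<in>B. (N - 1) / N * W * (w j)\<^sup>2)"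
        using w_sq by (intro sum_mono mult_right_mono) auto
      also have "\<dots> = (N - 1) / N * W * W" unfolding W_def by (rule sum_distrib_left[symmetric])
      also have "\<dots> = (N - 1) / N * W\<^sup>2" by (simp add: power2_eq_square)
      finally show ?thesis .
    qed
    have "(\<Sum>j\<in>B. f j ^ 4) = (\<Sum>j\<in>B. (w j - d) ^ 4)" by (simp add: w_def)
    also have "\<dots> \<le> (\<Sum>j\<in>B. 3 * w j ^ 4 + 8 * d\<^sup>2 * (w j)\<^sup>2 - 4 * d ^ 3 * w j + d ^ 4)"
      by (intro sum_mono shifted_fourth_power_le)
    also have "\<dots> = 3 * (\<Sum>j\<in>B. w j ^ 4) + 8 * d\<^sup>2 * W - 4 * d ^ 3 * sum w B + N * d ^ 4"
      by (simp add: sum.distrib sum_subtractf W_def B flip: sum_distrib_left)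
    also have "\<dots> \<le> 3 * ((N - 1) / N * W\<^sup>2) + 8 * d\<^sup>2 * W + N * d ^ 4"
      using w4 by (simp add: w0)
    also have "N * d ^ 4 = T\<^sup>2 / N ^ 3"
    proof -
      have "N * d ^ 4 = N * (T / N\<^sup>2)\<^sup>2" by (simp flip: d2)
      also have "\<dots> = T\<^sup>2 / N ^ 3" using N by (simp add: power2_eq_square power3_eq_cube)
      finally show ?thesis .
    qed
    finally have "(\<Sum>j\<in>B. f j ^ 4) \<le> 3 * (N - 1) / N * W\<^sup>2 + 8 * (T / N\<^sup>2) * W + T\<^sup>2 / N ^ 3"
      by (simp only: d2 mult.assoc times_divide_eq_left times_divide_eq_right)
    moreover have "(\<Sum>j\<in>A. f j ^ 4) = T\<^sup>2 + (\<Sum>j\<in>B. f j ^ 4)"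
      using sum.remove[OF fin i, of "\<lambda>j. f j ^ 4"] by (simp add: B_def T_def)
    moreover have "T = N * q - \<delta>" by (simp add: \<delta>_def)
    ultimately show ?thesis
      using remainder_bound[OF N \<delta> True] unfolding W by simp
  qed
qed

section \<open>Skewness, kurtosis and the maximum of the statistic\<close>

lemma sum_deviations_zero:
  assumes "n > 0"
  shows "(\<Sum>i=1..n. x i - sample_mean n x) = 0"
  using assms by (simp add: sum_subtractf sample_mean_def)

lemma central_moment_2_nonneg: "central_moment 2 n x \<ge> 0"
  by (simp add: central_moment_def sum_nonneg divide_nonneg_nonneg)

lemma central_moment_2_eq_0_iff:
  assumes "n > 0"
  shows "central_moment 2 n x = 0 \<longleftrightarrow> (\<forall>i\<in>{1..n}. x i = sample_mean n x)"
  using assms by (auto simp: central_moment_def sum_nonneg_eq_0_iff)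

lemma skewness_square: "(skewness n x)\<^sup>2 = (central_moment 3 n x)\<^sup>2 / central_moment 2 n x ^ 3"
proof (cases "central_moment 2 n x = 0")
  case False
  then have "central_moment 2 n x > 0" using central_moment_2_nonneg[of n x] by linarith
  then have "(central_moment 2 n x powr (3 / 2))\<^sup>2 = central_moment 2 n x ^ 3"
    by (simp add: power2_eq_square flip: powr_add)
  then show ?thesis by (simp add: skewness_def power_divide)
qed (simp add: skewness_def)

text \<open>Pearson's inequality. The deviations \<open>y\<close> have sum zero, so \<open>\<Sum>y\<^sup>3 = \<Sum>y(y\<^sup>2 - m\<^sub>2)\<close>, and
  Cauchy-Schwarz applies to the right-hand side.\<close>

lemma skewness_square_le_kurtosis:
  assumes n: "n > 0" and pos: "central_moment 2 n x \<noteq> 0"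
  shows "(skewness n x)\<^sup>2 \<le> kurtosis n x - 1"
proof -
  define y where "y i = x i - sample_mean n x" for i
  define m2 m3 m4 where m: "m2 = central_moment 2 n x" "m3 = central_moment 3 n x" "m4 = central_moment 4 n x"
  have s: "(\<Sum>i=1..n. y i) = 0" "(\<Sum>i=1..n. (y i)\<^sup>2) = n * m2" "(\<Sum>i=1..n. y i ^ 3) = n * m3" "(\<Sum>i=1..n. y i ^ 4) = n * m4"
    using n sum_deviations_zero[OF n] by (simp_all add: y_def m central_moment_def)
  have m2: "m2 > 0" using pos central_moment_2_nonneg[of n x] by (simp add: m)
  have "(\<Sum>i=1..n. y i * ((y i)\<^sup>2 - m2)) = (\<Sum>i=1..n. y i ^ 3) - m2 * (\<Sum>i=1..n. y i)"
    by (simp add: sum_distrib_left flip: sum_subtractf) (simp add: algebra_simps power2_eq_square power3_eq_cube)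
  then have "(real n * m3)\<^sup>2 \<le> (\<Sum>i=1..n. (y i)\<^sup>2) * (\<Sum>i=1..n. ((y i)\<^sup>2 - m2)\<^sup>2)"
    using Cauchy_Schwarz_ineq_sum[of y "\<lambda>i. (y i)\<^sup>2 - m2" "{1..n}"] by (simp add: s del: One_nat_def)
  also have "(\<Sum>i=1..n. ((y i)\<^sup>2 - m2)\<^sup>2) = (\<Sum>i=1..n. y i ^ 4 - 2 * m2 * (y i)\<^sup>2 + m2\<^sup>2)"
    by (intro sum.cong) (auto simp: power2_eq_square power4_eq_xxxx algebra_simps)
  also have "\<dots> = n * m4 - 2 * m2 * (n * m2) + n * m2\<^sup>2"
    by (simp add: sum.distrib sum_subtractf s flip: sum_distrib_left del: One_nat_def)
  also have "(\<Sum>i=1..n. (y i)\<^sup>2) * \<dots> = (real n)\<^sup>2 * (m2 * (m4 - m2\<^sup>2))"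
    unfolding s(2) by (simp add: algebra_simps power2_eq_square)
  finally have "m3\<^sup>2 \<le> m2 * (m4 - m2\<^sup>2)"
    using n by (simp add: power_mult_distrib)
  then show ?thesis
  proof -
    have "m3\<^sup>2 / m2 ^ 3 \<le> m2 * (m4 - m2\<^sup>2) / m2 ^ 3"
      using \<open>m3\<^sup>2 \<le> m2 * (m4 - m2\<^sup>2)\<close> m2 by (intro divide_right_mono) auto
    also have "\<dots> = m4 / m2\<^sup>2 - 1"
      using m2 by (simp add: power2_eq_square power3_eq_cube diff_divide_distrib)
    finally show ?thesis unfolding skewness_square kurtosis_def m[symmetric] .
  qed
qed

lemma kurtosis_le:
  assumes n: "n \<ge> 3" and pos: "central_moment 2 n x \<noteq> 0"
  shows "kurtosis n x \<le> (real n - 2)\<^sup>2 / (real n - 1) + 1"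
proof -
  define y where "y i = x i - sample_mean n x" for i
  define m2 m4 where m: "m2 = central_moment 2 n x" "m4 = central_moment 4 n x"
  have s: "(\<Sum>i=1..n. y i) = 0" "(\<Sum>i=1..n. (y i)\<^sup>2) = n * m2" "(\<Sum>i=1..n. y i ^ 4) = n * m4"
    using n sum_deviations_zero[of n x] by (simp_all add: y_def m central_moment_def)
  have m2: "m2 > 0" using pos central_moment_2_nonneg[of n x] by (simp add: m)
  define N where "N = real n - 1"
  have nN: "real n = N + 1" by (simp add: N_def)
  have N: "N \<ge> 2" using n by (simp add: N_def)
  have "(\<Sum>i=1..n. y i ^ 4) \<le> (N + 1) * m2\<^sup>2 * (N\<^sup>2 - N + 1) / N"
  proof (cases "n = 3")
    case True
    \<comment> \<open>Three numbers with sum zero satisfy \<open>\<Sum>y\<^sup>4 = (\<Sum>y\<^sup>2)\<^sup>2 / 2\<close>, so equality always holds.\<close>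
    have e: "{1..n} = {1, 2, 3}" using True by auto
    have "N = 2" using True by (simp add: N_def)
    have y: "y 3 = - y 1 - y 2" using s(1) unfolding e by simp
    have q: "m2 = ((y 1)\<^sup>2 + (y 2)\<^sup>2 + (y 3)\<^sup>2) / 3" using s(2) unfolding e by (simp add: True)
    have "a ^ 4 + (b ^ 4 + (- a - b) ^ 4) = 9 / 2 * ((a\<^sup>2 + b\<^sup>2 + (- a - b)\<^sup>2) / 3)\<^sup>2" for a b :: real
      by (simp add: power2_eq_square power4_eq_xxxx field_simps)
    from this[of "y 1" "y 2"] show ?thesis unfolding e q \<open>N = 2\<close> by (simp add: y)
  next
    case False
    then show ?thesis
      using n s nN by (intro zero_sum_fourth_power_le) auto
  qed
  then have "(N + 1) * m4 \<le> (N + 1) * (m2\<^sup>2 * ((N\<^sup>2 - N + 1) / N))"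
    unfolding s(3) nN by (simp add: mult.assoc)
  then have "m4 \<le> m2\<^sup>2 * ((N\<^sup>2 - N + 1) / N)" using N by (simp del: times_divide_eq_right)
  then have "m4 / m2\<^sup>2 \<le> (N\<^sup>2 - N + 1) / N"
    using m2 by (simp add: pos_divide_le_eq mult.commute del: times_divide_eq_right)
  also have "\<dots> = (real n - 2)\<^sup>2 / (real n - 1) + 1" 
    using N unfolding nN by (simp add: field_simps power2_eq_square)
  finally show ?thesis unfolding kurtosis_def m[symmetric] .
qed

definition JB_bound :: "nat \<Rightarrow> real" where
  "JB_bound n = real n * ((real n - 2) ^ 4 + 4 * (real n - 1)\<^sup>2) / (24 * (real n - 1)\<^sup>2)"

lemma JB_bound_alt:
  assumes "n \<ge> 3"
  shows "JB_bound n = real n / 24 * (((real n - 2)\<^sup>2 / (real n - 1))\<^sup>2 + 4)"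
  using assms by (simp add: JB_bound_def field_simps)

text \<open>After \<open>S\<^sup>2\<close> is replaced by its bound \<open>K - 1\<close>, the linear terms cancel:
  \<open>K - 1 + (K - 3)\<^sup>2 / 4 = ((K - 1)\<^sup>2 + 4) / 4\<close>. This increases in \<open>K \<ge> 1\<close>, so that small and large
  kurtosis need no separate treatment and the upper bound on \<open>K\<close> finishes the argument.\<close>

lemma JB_le_bound:
  assumes n: "n \<ge> 3" and pos: "central_moment 2 n x \<noteq> 0"
  shows "JB n x \<le> JB_bound n"
proof -
  define K where "K = kurtosis n x"
  have 1: "(skewness n x)\<^sup>2 \<le> K - 1" unfolding K_def
    using skewness_square_le_kurtosis n pos by auto
  then have K: "K \<ge> 1" using zero_le_power2[of "skewness n x"] by linarith
  have "(skewness n x)\<^sup>2 + 1 / 4 * (K - 3)\<^sup>2 \<le> (K - 1) + 1 / 4 * (K - 3)\<^sup>2" using 1 by simp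
  also have "\<dots> = ((K - 1)\<^sup>2 + 4) / 4" by (simp add: power2_eq_square field_simps)
  also have "\<dots> \<le> (((real n - 2)\<^sup>2 / (real n - 1))\<^sup>2 + 4) / 4"
    using K kurtosis_le[OF n pos] by (intro divide_right_mono add_right_mono power_mono) (auto simp: K_def)
  finally have "JB n x \<le> real n / 6 * ((((real n - 2)\<^sup>2 / (real n - 1))\<^sup>2 + 4) / 4)"
    unfolding JB_def K_def by (intro mult_left_mono) auto
  then show ?thesis by (simp add: JB_bound_alt[OF n])
qed

text \<open>The sample at which both moment inequalities are equalities.\<close>

definition one_outlier :: "nat \<Rightarrow> nat \<Rightarrow> real" where
  "one_outlier n i = (if i = 1 then real n - 1 else - 1)"

lemma sum_one_outlier:
  assumes "n \<ge> 1"
  shows "(\<Sum>i=1..n. g (one_outlier n i)) = g (real n - 1) + (real n - 1) * g (- 1)"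
proof -
  have "(\<Sum>i=1..n. g (one_outlier n i)) = g (one_outlier n 1) + (\<Sum>i\<in>{1..n} - {1}. g (one_outlier n i))"
    using assms by (intro sum.remove) auto
  also have "(\<Sum>i\<in>{1..n} - {1}. g (one_outlier n i)) = (\<Sum>i\<in>{1..n} - {1}. g (- 1))"
    by (intro sum.cong) (auto simp: one_outlier_def)
  finally show ?thesis using assms by (simp add: one_outlier_def of_nat_diff)
qed

lemma central_moment_one_outlier:
  assumes "n \<ge> 1"
  shows "central_moment r n (one_outlier n) = ((real n - 1) ^ r + (real n - 1) * (- 1) ^ r) / real n"
proof -
  have "sample_mean n (one_outlier n) = 0"
    using sum_one_outlier[OF assms, of "\<lambda>t. t"] by (simp add: sample_mean_def)
  then show ?thesis
    using sum_one_outlier[OF assms, of "\<lambda>t. t ^ r"] by (simp add: central_moment_def)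
qed

lemma central_moment_2_one_outlier:
  assumes "n \<ge> 1"
  shows "central_moment 2 n (one_outlier n) = real n - 1"
  using assms by (simp add: central_moment_one_outlier field_simps power2_eq_square)

lemma JB_one_outlier:
  assumes n: "n \<ge> 3"
  shows "JB n (one_outlier n) = JB_bound n"
proof -
  define N where "N = real n - 1"
  have nN: "real n = N + 1" by (simp add: N_def)
  have N: "N > 0" using n by (simp add: N_def)
  have m2: "central_moment 2 n (one_outlier n) = N"
    using n by (simp add: central_moment_2_one_outlier N_def)
  have m3: "central_moment 3 n (one_outlier n) = N * (N - 1)"
    using n N by (simp add: central_moment_one_outlier nN field_simps power3_eq_cube)
  have m4: "central_moment 4 n (one_outlier n) = N * (N\<^sup>2 - N + 1)"
    using n N by (simp add: central_moment_one_outlier nN field_simps power2_eq_square power4_eq_xxxx)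
  have S: "(skewness n (one_outlier n))\<^sup>2 = (N - 1)\<^sup>2 / N"
    unfolding skewness_square m2 m3 using N by (simp add: field_simps power2_eq_square power3_eq_cube)
  have K: "kurtosis n (one_outlier n) = (N - 1)\<^sup>2 / N + 1"
    unfolding kurtosis_def m2 m4 using N by (simp add: field_simps power2_eq_square)
  have "JB n (one_outlier n) = real n / 24 * (((N - 1)\<^sup>2 / N)\<^sup>2 + 4)"
    unfolding JB_def S K by (simp add: power2_eq_square algebra_simps)
  then show ?thesis by (simp add: JB_bound_alt[OF n] nN)
qed

lemma JB_bound_in_JB_values:
  assumes "n \<ge> 3"
  shows "JB_bound n \<in> JB_values n"
  using assms JB_one_outlier[of n] central_moment_2_one_outlier[of n]
  by (auto simp: JB_values_def intro!: exI[of _ "one_outlier n"])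

lemma J_plus_eq_JB_bound:
  assumes "n \<ge> 3"
  shows "J_plus n = JB_bound n"
  unfolding J_plus_def using assms JB_bound_in_JB_values JB_le_bound
  by (intro Greatest_equality) (auto simp: JB_values_def)



section \<open>The chi-square distribution with two degrees of freedom\<close>

text \<open>The two densities differ only at the origin.\<close>

lemma chi_square_2_eq_exponential:
  "chi_square 2 = density lborel (exponential_density (1 / 2))"
  unfolding chi_square_def
proof (rule density_cong)
  show "AE x in lborel. ennreal (chi_square_density 2 x) = ennreal (exponential_density (1 / 2) x)"
    using AE_lborel_singleton[of "0 :: real"]
    by eventually_elim (auto simp: chi_square_density_def exponential_density_def)
qed (unfold chi_square_density_def, measurable)

lemma is_upper_point_chi_square_2:
  assumes "0 < \<alpha>" "\<alpha> < 1"
  shows "is_upper_point (chi_square 2) \<alpha> (crit \<alpha>)"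
proof -
  let ?E = "density lborel (exponential_density (1 / 2))"
  interpret prob_space ?E by (intro prob_space_exponential_density) simp
  have "distributed ?E lborel (\<lambda>x. x) (exponential_density (1 / 2))"
    by (auto simp: distributed_def distr_id2)
  from exponential_distributedD_gt[OF this, of "crit \<alpha>"] have "prob {crit \<alpha><..} = \<alpha>"
    using assms by (simp add: crit_def greaterThan_def)
  then show ?thesis by (simp add: is_upper_point_def chi_square_2_eq_exponential)
qed

section \<open>The size of the test under normal sampling\<close>

lemma borel_measurable_JB:
  assumes [measurable]: "\<And>i. i \<in> {1..n} \<Longrightarrow> X i \<in> borel_measurable M"
  shows "(\<lambda>\<omega>. JB n (\<lambda>i. X i \<omega>)) \<in> borel_measurable M"
  unfolding JB_def skewness_def kurtosis_def central_moment_def sample_mean_def by measurable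

lemma JB_cong:
  assumes "\<And>i. i \<in> {1..n} \<Longrightarrow> x i = y i"
  shows "JB n x = JB n y"
proof -
  have "sample_mean n x = sample_mean n y" using assms by (simp add: sample_mean_def)
  then have "central_moment r n x = central_moment r n y" for r
    using assms by (simp add: central_moment_def)
  then show ?thesis by (simp add: JB_def skewness_def kurtosis_def)
qed

lemma isCont_JB:
  assumes "central_moment 2 n z \<noteq> 0"
  shows "isCont (JB n) z"
proof -
  have coord: "isCont (\<lambda>x. x i) z" for i :: nat and z :: "nat \<Rightarrow> real"
  proof -
    have "continuous_on UNIV (\<lambda>x :: nat \<Rightarrow> real. x i)" by (rule continuous_on_product_coordinates)
    then show ?thesis
      by (rule continuous_on_eq_continuous_at[OF open_UNIV, THEN iffD1, rule_format]) (rule UNIV_I)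
  qed
  have moment: "isCont (central_moment r n) z" for r
    unfolding central_moment_def[abs_def] sample_mean_def divide_inverse by (intro continuous_intros coord)
  have eq: "JB n = (\<lambda>x. real n / 6 * ((central_moment 3 n x)\<^sup>2 / central_moment 2 n x ^ 3
        + 1 / 4 * (kurtosis n x - 3)\<^sup>2))"
    by (simp add: fun_eq_iff JB_def skewness_square)
  show ?thesis unfolding eq kurtosis_def
    using assms by (intro continuous_intros moment) auto
qed

text \<open>The density vanishes nowhere, so a null set of the law is Lebesgue null, and a nonempty open
  set is not.\<close>

lemma normal_positive_on_open:
  assumes "distributed M lborel Y (normal_density \<mu> \<sigma>)" "\<sigma> > 0" "prob_space M" "open U" "U \<noteq> {}"
  shows "measure M (Y -` U \<inter> space M) > 0"
proof -
  interpret prob_space M by fact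
  have d: "distr M lborel Y = density lborel (normal_density \<mu> \<sigma>)" and [measurable]: "Y \<in> borel_measurable M"
    using assms(1) by (auto simp: distributed_def)
  have U: "U \<in> sets lborel" using \<open>open U\<close> by simp
  have "U \<notin> null_sets (density lborel (normal_density \<mu> \<sigma>))"
  proof
    assume "U \<in> null_sets (density lborel (normal_density \<mu> \<sigma>))"
    then have "AE x in lborel. x \<in> U \<longrightarrow> ennreal (normal_density \<mu> \<sigma> x) = 0"
      by (subst (asm) null_sets_density_iff) auto
    then have "AE x in lborel. x \<notin> U"
    proof eventually_elim
      case (elim x)
      then show ?case using normal_density_pos[OF \<open>\<sigma> > 0\<close>, of \<mu> x] by (auto simp: ennreal_eq_0_iff)
    qed
    then have "U \<in> null_sets lborel" using U by (simp add: AE_iff_null_sets[symmetric])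
    then have "negligible U" by (simp add: negligible_iff_null_sets null_sets_completionI)
    then show False using open_not_negligible assms by blast
  qed
  then have "emeasure (distr M lborel Y) U \<noteq> 0" using U by (auto simp: d null_sets_def)
  then have "emeasure M (Y -` U \<inter> space M) \<noteq> 0" using U by (simp add: emeasure_distr)
  then show ?thesis by (simp add: emeasure_eq_measure zero_less_measure_iff)
qed

text \<open>A constant sample has \<open>X\<^sub>1 = X\<^sub>2\<close>, while \<open>X\<^sub>1 - X\<^sub>2\<close> is normal and hence has no atom at 0.\<close>

lemma normal_sample_constant_null:
  assumes "prob_space M" "n \<ge> 2" "\<sigma> > 0" "normal_sample M n \<mu> \<sigma> X"
  shows "AE \<omega> in M. central_moment 2 n (\<lambda>i. X i \<omega>) \<noteq> 0"
proof -
  interpret prob_space M by fact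
  have "indep_vars (\<lambda>_. borel) X {1..n}" and X: "\<And>i. i \<in> {1..n} \<Longrightarrow> distributed M lborel (X i) (normal_density \<mu> \<sigma>)"
    using assms by (auto simp: normal_sample_def)
  then have "indep_vars (\<lambda>_. borel) X (insert 1 {2})"
    using \<open>n \<ge> 2\<close> by (elim indep_vars_subset) auto
  from indep_vars_sum[OF _ _ this] have "indep_var borel (X 1) borel (X 2)" by simp
  from diff_indep_normal[OF this \<open>\<sigma> > 0\<close> \<open>\<sigma> > 0\<close> X X]
  have D: "distributed M lborel (\<lambda>\<omega>. X 1 \<omega> - X 2 \<omega>) (normal_density (\<mu> - \<mu>) (sqrt (\<sigma>\<^sup>2 + \<sigma>\<^sup>2)))"
    using \<open>n \<ge> 2\<close> by simp
  have "AE \<omega> in M. X 1 \<omega> - X 2 \<omega> \<noteq> 0"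
    using AE_lborel_singleton[of "0::real"]
    by (subst distributed_AE2[OF D, of "\<lambda>x. x \<noteq> 0"]) auto
  then show ?thesis
  proof eventually_elim
    case (elim \<omega>)
    have "X 1 \<omega> = X 2 \<omega>" if "central_moment 2 n (\<lambda>i. X i \<omega>) = 0"
      using that \<open>n \<ge> 2\<close> unfolding central_moment_2_eq_0_iff[of n, OF order.strict_trans2[OF _ \<open>n \<ge> 2\<close>], simplified]
      by auto
    then show ?case using elim by auto
  qed
qed

text \<open>If the maximum does not exceed the critical value, rejection is confined to the null event of a
  constant sample, on which \<open>JB\<close> takes a conventional value that may well exceed the maximum.
  Conversely, if the maximum exceeds the critical value, then by continuity at the maximizer a box
  of samples around it is rejected, and by independence the probability of the box is a product of
  positive numbers.\<close>

lemma rejection_prob_eq_0_iff: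
  assumes "prob_space M" "n \<ge> 3" "\<sigma> > 0" "normal_sample M n \<mu> \<sigma> X"
  shows "rejection_prob M n X \<alpha> = 0 \<longleftrightarrow> J_plus n \<le> crit \<alpha>"
proof -
  interpret prob_space M by fact
  have indep: "indep_vars (\<lambda>_. borel) X {1..n}"
    and X: "\<And>i. i \<in> {1..n} \<Longrightarrow> distributed M lborel (X i) (normal_density \<mu> \<sigma>)"
    using assms by (auto simp: normal_sample_def)
  have meas: "X i \<in> borel_measurable M" if "i \<in> {1..n}" for i
    using X[OF that] by (auto simp: distributed_def)
  note [measurable] = borel_measurable_JB[of n X M, OF meas]
  show ?thesis
  proof
    assume le: "J_plus n \<le> crit \<alpha>"
    have "AE \<omega> in M. central_moment 2 n (\<lambda>i. X i \<omega>) \<noteq> 0"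
      using assms by (intro normal_sample_constant_null) auto
    then have "AE \<omega> in M. \<not> JB n (\<lambda>i. X i \<omega>) > crit \<alpha>"
    proof eventually_elim
      case (elim \<omega>)
      show ?case using JB_le_bound[OF \<open>n \<ge> 3\<close> elim] le J_plus_eq_JB_bound[OF \<open>n \<ge> 3\<close>] by simp
    qed
    then show "rejection_prob M n X \<alpha> = 0"
      unfolding rejection_prob_def by (intro prob_eq_0_AE) auto
  next
    assume zero: "rejection_prob M n X \<alpha> = 0"
    show "J_plus n \<le> crit \<alpha>"
    proof (rule ccontr)
      assume "\<not> J_plus n \<le> crit \<alpha>"
      then have "JB n (one_outlier n) > crit \<alpha>"
        using JB_one_outlier J_plus_eq_JB_bound \<open>n \<ge> 3\<close> by simp
      moreover have "isCont (JB n) (one_outlier n)"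
        using \<open>n \<ge> 3\<close> by (intro isCont_JB) (simp add: central_moment_2_one_outlier)
      ultimately have "\<forall>\<^sub>F x in nhds (one_outlier n). JB n x > crit \<alpha>"
        by (intro order_tendstoD(1)) (auto simp: isCont_def tendsto_at_iff_tendsto_nhds)
      then obtain V where V: "open V" "one_outlier n \<in> V" "\<And>x. x \<in> V \<Longrightarrow> JB n x > crit \<alpha>"
        by (auto simp: eventually_nhds)
      then obtain U where U: "one_outlier n \<in> Pi\<^sub>E UNIV U" "\<And>i. open (U i)" "Pi\<^sub>E UNIV U \<subseteq> V"
        using product_topology_open_contains_basis[of "\<lambda>_. euclidean" UNIV V "one_outlier n"]
        by (auto simp: open_fun_def)
      let ?R = "{\<omega>\<in>space M. JB n (\<lambda>i. X i \<omega>) > crit \<alpha>}"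
      have "0 < (\<Prod>i\<in>{1..n}. prob (X i -` U i \<inter> space M))"
        using U X assms by (intro prod_pos ballI normal_positive_on_open[of M _ \<mu> \<sigma>]) (auto simp: PiE_iff)
      also have "\<dots> = prob (\<Inter>i\<in>{1..n}. X i -` U i \<inter> space M)"
        using U \<open>n \<ge> 3\<close> by (intro indep_varsD_finite[OF indep, symmetric]) auto
      also have "\<dots> \<le> prob ?R"
      proof (rule finite_measure_mono)
        show "(\<Inter>i\<in>{1..n}. X i -` U i \<inter> space M) \<subseteq> ?R"
        proof
          fix \<omega> assume \<omega>: "\<omega> \<in> (\<Inter>i\<in>{1..n}. X i -` U i \<inter> space M)"
          \<comment> \<open>The box constrains all coordinates, but \<open>JB n\<close> reads only the first \<open>n\<close>.\<close>
          define y where "y i = (if i \<in> {1..n} then X i \<omega> else one_outlier n i)" for i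
          have "y \<in> Pi\<^sub>E UNIV U" using \<omega> U(1) by (auto simp: y_def PiE_iff)
          then have "JB n y > crit \<alpha>" using U V by auto
          moreover have "JB n y = JB n (\<lambda>i. X i \<omega>)" by (rule JB_cong) (simp add: y_def)
          ultimately show "\<omega> \<in> ?R" using \<omega> \<open>n \<ge> 3\<close> by auto
        qed
      qed measurable
      finally show False using zero by (simp add: rejection_prob_def)
    qed
  qed
qed

section \<open>Critical values at the usual levels\<close>

text \<open>This gives \<open>2 ln 20 < 6\<close>, which separates the 5 percent point 5.99 from the value
  \<open>JB_bound 7\<close>, about 6.23. The margin is narrow: \<open>e\<^sup>3\<close> is about 20.09.\<close>

lemma exp_3_gt_20: "exp (3 :: real) > 20"
proof -
  have "(2718 / 1000 :: real) < 5837465777 / 2147483648 - inverse (2 ^ 32)" by simp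
  also have "\<dots> \<le> exp 1"
    using abs_le_D2[OF e_approx_32] by (simp only: minus_diff_eq diff_le_eq add.commute)
  finally have "(2718 / 1000 :: real) < exp 1" .
  then have "exp 1 ^ 3 > (2718 / 1000 :: real) ^ 3" by (intro power_strict_mono) auto
  also have "exp 1 ^ 3 = exp (3::real)" by (simp flip: exp_of_nat_mult)
  finally show ?thesis by (simp add: power3_eq_cube)
qed

lemma crit_eq:
  assumes "\<alpha> > 0"
  shows "crit \<alpha> = 2 * ln (1 / \<alpha>)"
  using assms by (simp add: crit_def ln_div)

lemma crit_bounds:
  shows "4 < crit (10 / 100)" "crit (5 / 100) < 6" "8 < crit (1 / 100)" "crit (1 / 100) < 10"
proof -
  have "exp 1 ^ 2 < (3 :: real) ^ 2" using e_less_272 by (intro power_strict_mono) auto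
  then have "exp 2 < (10 :: real)" by (simp flip: exp_of_nat_mult)
  then have "ln (exp 2) < ln (10 :: real)" by (subst ln_less_cancel_iff) auto
  then have ln10: "2 < ln (10 :: real)" by simp
  then show "4 < crit (10 / 100)" by (simp add: crit_eq)
  have "ln (100 :: real) = 2 * ln 10" using ln_mult[of 10 10] by simp
  then show "8 < crit (1 / 100)" using ln10 by (simp add: crit_eq)
  have "ln 20 < ln (exp (3 :: real))" using exp_3_gt_20 by (subst ln_less_cancel_iff) auto
  then show "crit (5 / 100) < 6" by (simp add: crit_eq)
  have "exp (2 :: real) \<ge> 5" using exp_lower_Taylor_quadratic[of 2] by simp
  then have "20 * 5 < exp 3 * exp (2 :: real)" using exp_3_gt_20 by (intro mult_less_le_imp_less) auto
  then have "100 < exp (5 :: real)" by (simp flip: exp_add)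
  then have "ln 100 < ln (exp (5 :: real))" by (subst ln_less_cancel_iff) auto
  then show "crit (1 / 100) < 10" by (simp add: crit_eq)
qed

lemma crit_antimono:
  assumes "0 < \<alpha>" "\<alpha> \<le> \<beta>"
  shows "crit \<beta> \<le> crit \<alpha>"
  using assms by (simp add: crit_def)

text \<open>With \<open>a = m - 1\<close> and \<open>b = n - 1\<close>, the map \<open>a \<mapsto> (a - 1)\<^sup>2 / a = a - 2 + 1 / a\<close> increases for
  \<open>a \<ge> 1\<close>; cross-multiplied, this is \<open>(b - a)(ab - 1) \<ge> 0\<close>.\<close>

lemma JB_bound_mono:
  assumes "3 \<le> m" "m \<le> n"
  shows "JB_bound m \<le> JB_bound n"
proof -
  define a b where ab: "a = real m - 1" "b = real n - 1"
  have a: "a \<ge> 2" "a \<le> b" using assms by (auto simp: ab)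
  have "1 \<le> a * b" using mult_mono[of 1 a 1 b] a by simp
  then have "0 \<le> (b - a) * (a * b - 1)" using a by simp
  also have "\<dots> = (b - 1)\<^sup>2 * a - (a - 1)\<^sup>2 * b" by (simp add: power2_eq_square algebra_simps)
  finally have "(a - 1)\<^sup>2 / a \<le> (b - 1)\<^sup>2 / b" using a by (simp add: divide_le_eq pos_le_divide_eq)
  then have "(real m - 2)\<^sup>2 / (real m - 1) \<le> (real n - 2)\<^sup>2 / (real n - 1)" by (simp add: ab)
  then have "((real m - 2)\<^sup>2 / (real m - 1))\<^sup>2 \<le> ((real n - 2)\<^sup>2 / (real n - 1))\<^sup>2"
    using assms by (intro power_mono) auto
  then show ?thesis
    using assms by (simp only: JB_bound_alt order.trans[OF assms]) (intro mult_mono; simp)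
qed

lemma JB_bound_le_iff:
  assumes "3 \<le> k" "JB_bound k \<le> c" "c < JB_bound (Suc k)" "3 \<le> n"
  shows "JB_bound n \<le> c \<longleftrightarrow> n \<le> k"
  using assms JB_bound_mono[of n k] JB_bound_mono[of "Suc k" n] by (cases "n \<le> k") auto

theorem corollary1:
  fixes M :: "'a measure" and X :: "nat \<Rightarrow> 'a \<Rightarrow> real"
    and n :: nat and \<mu> \<sigma> :: real
  assumes "prob_space M"
    and "n \<ge> 3"
    and "\<sigma> > 0"
    and "normal_sample M n \<mu> \<sigma> X"
  shows "J_plus n \<in> JB_values n \<and> (\<forall>v\<in>JB_values n. v \<le> J_plus n) \<and>
     J_plus n = real n * ((real n - 2) ^ 4 + 4 * (real n - 1)\<^sup>2) / (24 * (real n - 1)\<^sup>2) \<and>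
     (\<forall>\<alpha>. 0 < \<alpha> \<and> \<alpha> < 1 \<longrightarrow>
        is_upper_point (chi_square 2) \<alpha> (crit \<alpha>) \<and>
        (rejection_prob M n X \<alpha> = 0 \<longleftrightarrow> J_plus n \<le> crit \<alpha>)) \<and>
     (rejection_prob M n X (10 / 100) = 0 \<longleftrightarrow> n \<le> 6) \<and>
     (rejection_prob M n X (5 / 100) = 0 \<longleftrightarrow> n \<le> 6) \<and>
     (rejection_prob M n X (1 / 100) = 0 \<longleftrightarrow> n \<le> 7)"
proof -
  note J = J_plus_eq_JB_bound[OF \<open>n \<ge> 3\<close>]
  have size_zero: "rejection_prob M n X \<alpha> = 0 \<longleftrightarrow> JB_bound n \<le> crit \<alpha>" for \<alpha>
    using rejection_prob_eq_0_iff[OF assms] by (simp add: J)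
  have bounds: "JB_bound 6 < 4" "6 < JB_bound 7" "JB_bound 7 < 8" "10 < JB_bound 8"
    by (simp_all add: JB_bound_def)
  have "crit (10 / 100) \<le> crit (5 / 100)" by (rule crit_antimono) simp_all
  with bounds crit_bounds
  have "JB_bound 6 \<le> crit (10 / 100)" "crit (10 / 100) < JB_bound (Suc 6)"
    "JB_bound 6 \<le> crit (5 / 100)" "crit (5 / 100) < JB_bound (Suc 6)"
    "JB_bound 7 \<le> crit (1 / 100)" "crit (1 / 100) < JB_bound (Suc 7)"
    unfolding Suc_numeral semiring_norm by linarith+
  then have "JB_bound n \<le> crit (10 / 100) \<longleftrightarrow> n \<le> 6" "JB_bound n \<le> crit (5 / 100) \<longleftrightarrow> n \<le> 6"
    "JB_bound n \<le> crit (1 / 100) \<longleftrightarrow> n \<le> 7"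
    by (intro JB_bound_le_iff \<open>n \<ge> 3\<close>; simp)+
  moreover have "JB_bound n \<in> JB_values n" "\<forall>v\<in>JB_values n. v \<le> JB_bound n"
    using JB_bound_in_JB_values JB_le_bound \<open>n \<ge> 3\<close> by (auto simp: JB_values_def)
  ultimately show ?thesis
    unfolding size_zero J using is_upper_point_chi_square_2 by (simp add: JB_bound_def)
qed

end
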